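(* The set $\mathbf{S}'=\mathbf{S}\setminus\mathbf{NMC}$ is a perfect subset of $\mathbf{S}$ (i.e. it is closed in $\mathbf{S}$ and has no isolated points in the subspace topology).
   Context: A subshift is a nonempty compact set $X\subset\mathbb{Z}^{\mathbb{Z}}$ (product topology, $\mathbb{Z}$ discrete) with $\sigma(X)=X$, where $(\sigma x)_i=x_{i+1}$; it is automatically over a finite alphabet. $L_n(X)$ is the set of $n$-letter words occurring in points of $X$. $\mathbf{S}$ is the set of all subshifts with the metric $d(X,Y)=2^{-\inf\{n:L_n(X)\ne L_n(Y)\}}$ ($d(X,X)=0$). The $n$th Rauzy graph $G_{X,n}$ is the directed graph with vertex set $L_{n-1}(X)$ and, for each $w_1\cdots w_n\in L_n(X)$, an edge from $w_1\cdots w_{n-1}$ to $w_2\cdots w_n$. A directed graph has the no middle cycles property (NMC) if it contains no cycle $K$ which has both an incoming edge (an edge whose terminal vertex is in $K$ and whose initial vertex is not in $K$) and an outgoing edge (an edge whose initial vertex is in $K$ and whose terminal vertex is not in $K$). A subshift $X$ is NMC if there exists $n\ge2$ for which $G_{X,n}$ has NMC; $\mathbf{NMC}$ is the set of NMC subshifts. *)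

theory Defs
  imports "HOL-Analysis.Analysis" "Graph_Theory.Graph_Theory"
begin

section \<open>Subshifts\<close>

definition shift_map :: "(int \<Rightarrow> int) \<Rightarrow> (int \<Rightarrow> int)" where
  "shift_map x = (\<lambda>i. x (i + 1))"

text \<open>\<^term>\<open>compact\<close> on functions refers to the product topology, and the topology of
  \<^typ>\<open>int\<close> is discrete.\<close>
definition subshifts :: "(int \<Rightarrow> int) set set" where
  "subshifts = {X. X \<noteq> {} \<and> compact X \<and> shift_map ` X = X}"

definition word_at :: "(int \<Rightarrow> int) \<Rightarrow> int \<Rightarrow> nat \<Rightarrow> int list" where
  "word_at x i n = map (\<lambda>k. x (i + int k)) [0..<n]"

definition language :: "nat \<Rightarrow> (int \<Rightarrow> int) set \<Rightarrow> int list set" where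
  "language n X = {word_at x i n | x i. x \<in> X}"

text \<open>The infimum is over a nonempty set of naturals whenever \<open>X \<noteq> Y\<close> are subshifts
  (lemma \<open>subshift_eqI\<close> below).\<close>
definition subshift_dist :: "(int \<Rightarrow> int) set \<Rightarrow> (int \<Rightarrow> int) set \<Rightarrow> real" where
  "subshift_dist X Y =
    (if X = Y then 0 else 2 powr - real (Inf {n. language n X \<noteq> language n Y}))"

lemma shift_invariant:
  assumes "shift_map ` X = X" "x \<in> X"
  shows "(\<lambda>i. x (i + j)) \<in> X"
proof (induction j rule: int_induct[where k = 0])
  case base
  then show ?case using assms by simp
next
  case (step1 j)
  have "shift_map (\<lambda>i. x (i + j)) \<in> X" using step1 assms(1) by blast
  then show ?case by (simp add: shift_map_def algebra_simps)
next
  case (step2 j)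
  then obtain z where z: "z \<in> X" "(\<lambda>i. x (i + j)) = shift_map z"
    using assms(1) by blast
  have "z i = x (i + (j - 1))" for i
    using fun_cong[OF z(2), of "i - 1"] by (simp add: shift_map_def algebra_simps)
  then have "z = (\<lambda>i. x (i + (j - 1)))" by blast
  then show ?case using z(1) by simp
qed

lemma subshift_subsetI:
  assumes X: "X \<in> subshifts" and Y: "Y \<in> subshifts"
    and L: "\<And>n. language n X = language n Y"
  shows "X \<subseteq> Y"
proof
  fix x assume x: "x \<in> X"
  have "\<exists>y\<in>Y. \<forall>i. \<bar>i\<bar> \<le> int m \<longrightarrow> y i = x i" for m :: nat
  proof -
    have "word_at x (- int m) (2 * m + 1) \<in> language (2 * m + 1) Y"
      using x L[of "2 * m + 1"] unfolding language_def by blast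
    then obtain z j where z: "z \<in> Y" "word_at x (- int m) (2 * m + 1) = word_at z j (2 * m + 1)"
      unfolding language_def by blast
    define y where "y = (\<lambda>i. z (i + (j + int m)))"
    have "y \<in> Y"
      unfolding y_def using Y z(1) by (intro shift_invariant) (auto simp: subshifts_def)
    moreover have "y i = x i" if "\<bar>i\<bar> \<le> int m" for i
    proof -
      have k: "nat (i + int m) < 2 * m + 1" "0 \<le> i + int m" using that by linarith+
      have "word_at x (- int m) (2 * m + 1) ! nat (i + int m)
          = word_at z j (2 * m + 1) ! nat (i + int m)" using z(2) by simp
      then show ?thesis
        using k by (simp add: word_at_def y_def algebra_simps del: upt_Suc)
    qed
    ultimately show ?thesis by blast
  qed
  then obtain y where y: "\<And>m. y m \<in> Y" "\<And>m i. \<bar>i\<bar> \<le> int m \<Longrightarrow> y m i = x i"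
    by metis
  have "((\<lambda>m. y m i) \<longlongrightarrow> x i) sequentially" for i
  proof (rule tendsto_eventually)
    show "eventually (\<lambda>m. y m i = x i) sequentially"
      using y(2) by (intro eventually_sequentiallyI[of "nat \<bar>i\<bar>"]) auto
  qed
  then have "limitin (product_topology (\<lambda>_. euclidean) UNIV) y x sequentially"
    by (simp add: limitin_componentwise)
  then have "(y \<longlongrightarrow> x) sequentially"
    by (simp add: euclidean_product_topology)
  moreover have "closed Y"
  proof -
    have "Hausdorff_space (euclidean :: int topology)"
      unfolding Hausdorff_space_def disjnt_def using hausdorff by auto
    then have "Hausdorff_space (product_topology (\<lambda>_::int. euclidean :: int topology) UNIV)"
      by (simp add: Hausdorff_space_product_topology)
    then have "Hausdorff_space (euclidean :: (int \<Rightarrow> int) topology)"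
      by (simp only: euclidean_product_topology)
    moreover have "compactin euclidean Y"
      using Y by (simp add: subshifts_def)
    ultimately show ?thesis
      using compactin_imp_closedin closed_closedin by metis
  qed
  ultimately show "x \<in> Y"
    using y(1) by (intro Lim_in_closed_set[of Y y sequentially]) auto
qed

lemma subshift_eqI:
  assumes "X \<in> subshifts" "Y \<in> subshifts" "\<And>n. language n X = language n Y"
  shows "X = Y"
  using assms subshift_subsetI by (metis subset_antisym)

interpretation subshift: Metric_space subshifts subshift_dist
proof
  fix X Y :: "(int \<Rightarrow> int) set"
  show "0 \<le> subshift_dist X Y" by (simp add: subshift_dist_def)
  have "{n. language n X \<noteq> language n Y} = {n. language n Y \<noteq> language n X}" by auto
  then show "subshift_dist X Y = subshift_dist Y X" by (simp add: subshift_dist_def)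
  show "subshift_dist X Y = 0 \<longleftrightarrow> X = Y" by (simp add: subshift_dist_def)
next
  fix X Y Z
  assume S: "X \<in> subshifts" "Y \<in> subshifts" "Z \<in> subshifts"
  show "subshift_dist X Z \<le> subshift_dist X Y + subshift_dist Y Z"
  proof (cases "X = Y \<or> Y = Z \<or> X = Z")
    case True
    then show ?thesis by (auto simp: subshift_dist_def)
  next
    case False
    let ?N = "\<lambda>A B. Inf {n. language n A \<noteq> language n B}"
    have "\<exists>n. language n X \<noteq> language n Z"
      using False S subshift_eqI by metis
    then have "?N X Z \<in> {n. language n X \<noteq> language n Z}"
      by (intro Inf_nat_def1) auto
    then have "?N X Z \<in> {n. language n X \<noteq> language n Y}
        \<or> ?N X Z \<in> {n. language n Y \<noteq> language n Z}"
      unfolding mem_Collect_eq by argo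
    then have "?N X Y \<le> ?N X Z \<or> ?N Y Z \<le> ?N X Z"
      by (elim disjE) (intro disjI1 wellorder_Inf_le1, assumption, intro disjI2 wellorder_Inf_le1, assumption)
    then have "(2::real) powr - real (?N X Z) \<le> 2 powr - real (?N X Y)
        \<or> (2::real) powr - real (?N X Z) \<le> 2 powr - real (?N Y Z)"
      by auto
    moreover have "(0::real) \<le> 2 powr - real (?N X Y)" "(0::real) \<le> 2 powr - real (?N Y Z)"
      by simp_all
    ultimately have "(2::real) powr - real (?N X Z) \<le> 2 powr - real (?N X Y) + 2 powr - real (?N Y Z)"
      by linarith
    then show ?thesis
      using False by (simp only: subshift_dist_def de_Morgan_disj if_False)
  qed
qed

section \<open>Rauzy graphs and the no middle cycles property\<close>

definition rauzy_graph :: "(int \<Rightarrow> int) set \<Rightarrow> nat \<Rightarrow> (int list, int list) pre_digraph" where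
  "rauzy_graph X n =
    \<lparr>verts = language (n - 1) X, arcs = language n X, tail = butlast, head = tl\<rparr>"

text \<open>Cycles are given by their arcs; \<^term>\<open>pre_digraph.cycle\<close> requires distinct vertices
  and admits loops. Every vertex of a cycle is the tail of one of its arcs.\<close>
definition no_middle_cycles :: "('a, 'b) pre_digraph \<Rightarrow> bool" where
  "no_middle_cycles G \<longleftrightarrow>
    \<not> (\<exists>p. pre_digraph.cycle G p \<and>
        (let K = tail G ` set p in
          (\<exists>e\<in>arcs G. head G e \<in> K \<and> tail G e \<notin> K) \<and>
          (\<exists>e\<in>arcs G. tail G e \<in> K \<and> head G e \<notin> K)))"

definition NMC_subshifts :: "(int \<Rightarrow> int) set set" where
  "NMC_subshifts = {X \<in> subshifts. \<exists>n\<ge>2. no_middle_cycles (rauzy_graph X n)}"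

section \<open>Perfect subsets of a topological space\<close>

definition perfect_in :: "'a topology \<Rightarrow> 'a set \<Rightarrow> bool" where
  "perfect_in T A \<longleftrightarrow> closedin T A \<and> (\<forall>x\<in>A. \<not> openin (subtopology T A) {x})"

end

theory Submission
  imports Defs
begin

text \<open>
  Two subshifts are close exactly when they have the same words up to some length, and the
  Rauzy graph at level \<open>n\<close> is determined by the words of length at most \<open>n\<close>. So a subshift
  close to an NMC subshift \<open>X\<close> shares with it the Rauzy graph that witnesses NMC: the NMC subshifts
  form an open set, and its complement is closed.

  For the absence of isolated points, let \<open>X\<close> be a subshift that is not NMC and let \<open>r \<ge> 1\<close>. The
  task is to find another such subshift with the same words of length \<open>r + 1\<close>. The Rauzy graph
  at level \<open>r + 1\<close> has a middle cycle; reading its letters round and round gives a periodic sequence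
  \<open>c\<close>, whose \<open>r\<close>-letter words are the vertex set \<open>K\<close> of the cycle (\<open>middle_cycle_obtain\<close>). There are two
  candidates:

  \<^item> \<open>S\<close>, all bi-infinite walks in this graph (a shift of finite type containing \<open>X\<close>);
  \<^item> \<open>T\<close>, those walks in \<open>S\<close> that never leave \<open>K\<close> once they have entered it.

  They differ, because some walk in \<open>S\<close> comes in by an incoming edge, runs along the cycle and goes out by an
  outgoing edge. Hence at least one of them is different from \<open>X\<close>, and it remains to see that both
  have the required properties.

  Every edge of the graph lies on a walk in \<open>T\<close>: start from any walk through it and,
  where this walk first meets \<open>K\<close> in the future, run round the cycle forever instead; do
  likewise in the past (\<open>point_through_word\<close>). So \<open>S\<close> and \<open>T\<close> have the same words of length \<open>r + 1\<close> as \<open>X\<close>,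
  and their Rauzy graphs up to level \<open>r + 1\<close> are those of \<open>X\<close>, which all have middle cycles. Moreover \<open>T\<close>
  contains a point that passes an incoming edge and then follows \<open>c\<close> forever, and
  a point that has always followed \<open>c\<close> and then passes an outgoing edge. These two points
  turn the words of \<open>c\<close> into a middle cycle of every longer Rauzy graph as well
  (\<open>middle_cycle_longer_words\<close>). So neither \<open>S\<close> nor \<open>T\<close> is NMC.
\<close>

section \<open>Words and languages\<close>

lemma word_at_eq_iff:
  "word_at x i m = word_at y j m \<longleftrightarrow> (\<forall>k<m. x (i + int k) = y (j + int k))"
  by (auto simp: word_at_def)

lemma length_word_at [simp]: "length (word_at x i m) = m"
  by (simp add: word_at_def)

lemma word_at_shift: "word_at (\<lambda>k. x (k + d)) i m = word_at x (i + d) m"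
  by (simp add: word_at_eq_iff algebra_simps)

lemma take_word_at: "k \<le> m \<Longrightarrow> take k (word_at x i m) = word_at x i k"
  by (intro nth_equalityI) (simp_all add: word_at_def)

lemma drop_word_at: "drop k (word_at x i (k + m)) = word_at x (i + int k) m"
  by (intro nth_equalityI) (simp_all add: word_at_def add.assoc)

lemma butlast_word_at: "butlast (word_at x i (Suc m)) = word_at x i m"
  by (simp add: butlast_conv_take take_word_at)

lemma tl_word_at: "tl (word_at x i (Suc m)) = word_at x (i + 1) m"
  using drop_word_at[of 1 x i m] by (simp add: drop_Suc)

lemma word_at_in_language: "x \<in> X \<Longrightarrow> word_at x i m \<in> language m X"
  unfolding language_def by blast

lemma subshift_shift:
  assumes "X \<in> subshifts" "x \<in> X"
  shows "(\<lambda>i. x (i + d)) \<in> X"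
  using assms by (intro shift_invariant) (auto simp: subshifts_def)

lemma language_at_0:
  assumes "X \<in> subshifts" "w \<in> language m X"
  obtains x where "x \<in> X" "word_at x 0 m = w"
proof -
  obtain x i where x: "x \<in> X" "w = word_at x i m"
    using assms(2) unfolding language_def by blast
  show thesis
    by (rule that[OF subshift_shift[OF assms(1) x(1), of i]]) (simp add: word_at_shift x(2))
qed

text \<open>The shorter words are the prefixes of the longer ones, because every point extends
  infinitely to the right.\<close>
lemma language_eq_mono:
  assumes "language n X = language n Y" "m \<le> n"
  shows "language m X = language m Y"
proof -
  have "language m Z = take m ` language n Z" for Z
  proof -
    have "take m ` language n Z = (\<Union>x\<in>Z. \<Union>i. {take m (word_at x i n)})"
      unfolding language_def by blast
    also have "\<dots> = (\<Union>x\<in>Z. \<Union>i. {word_at x i m})"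
      using assms(2) by (simp add: take_word_at)
    also have "\<dots> = language m Z" unfolding language_def by blast
    finally show ?thesis by simp
  qed
  then show ?thesis using assms(1) by simp
qed

section \<open>Shifts of finite type over the alphabet of a subshift\<close>

text \<open>The letters are discrete, so fixing finitely many coordinates is an open condition, both
  for such a set and for its complement.\<close>
lemma clopen_finitely_determined:
  fixes S :: "(int \<Rightarrow> int) set"
  assumes "finite F" and S: "\<And>x y. (\<forall>i\<in>F. x i = y i) \<Longrightarrow> x \<in> S \<Longrightarrow> y \<in> S"
  shows "open S" "closed S"
proof -
  have cyl: "open {y. \<forall>i\<in>F. y i = x i}" for x :: "int \<Rightarrow> int"
  proof -
    have "{y. \<forall>i\<in>F. y i = x i} = (\<Inter>i\<in>F. (\<lambda>y. y i) -` {x i})" by auto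
    moreover have "open ((\<lambda>y::int \<Rightarrow> int. y i) -` {x i})" for i
      by (intro open_vimage open_discrete continuous_on_product_coordinates)
    ultimately show ?thesis using assms(1) by (simp add: open_INT)
  qed
  have op: "open T" if T: "\<And>x y. (\<forall>i\<in>F. x i = y i) \<Longrightarrow> x \<in> T \<Longrightarrow> y \<in> T" for T :: "(int \<Rightarrow> int) set"
  proof -
    have "open (\<Union>x\<in>T. {y. \<forall>i\<in>F. y i = x i})"
      by (intro open_UN ballI cyl)
    moreover have "(\<Union>x\<in>T. {y. \<forall>i\<in>F. y i = x i}) = T"
    proof
      show "(\<Union>x\<in>T. {y. \<forall>i\<in>F. y i = x i}) \<subseteq> T"
      proof
        fix y assume "y \<in> (\<Union>x\<in>T. {y. \<forall>i\<in>F. y i = x i})"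
        then obtain x where x: "x \<in> T" "\<forall>i\<in>F. x i = y i" by auto
        show "y \<in> T" by (rule T[OF x(2,1)])
      qed
    qed auto
    ultimately show ?thesis by simp
  qed
  show "open S" using S by (rule op)
  have "open (- S)"
  proof (rule op)
    fix x y assume "\<forall>i\<in>F. x i = y i" "x \<in> - S"
    then show "y \<in> - S" using S[of y x] by auto
  qed
  then show "closed S" by (simp add: closed_def)
qed

lemma clopen_word_at: "closed {x. P (word_at x i m)}" "open {x. P (word_at x i m)}"
proof -
  have *: "word_at x i m = word_at y i m" if "\<forall>j\<in>{i..<i + int m}. x j = y j" for x y
    using that by (simp add: word_at_eq_iff)
  show "closed {x. P (word_at x i m)}"
    by (rule clopen_finitely_determined(2)[of "{i..<i + int m}"]) (use * in \<open>force+\<close>)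
  show "open {x. P (word_at x i m)}"
    by (rule clopen_finitely_determined(1)[of "{i..<i + int m}"]) (use * in \<open>force+\<close>)
qed

text \<open>The shift of finite type with allowed words \<open>L\<close>; when \<open>L\<close> consists of the \<open>m\<close>-letter words of a
  subshift, its points are the bi-infinite walks in the Rauzy graph at level \<open>m\<close>.\<close>
definition sft :: "nat \<Rightarrow> int list set \<Rightarrow> (int \<Rightarrow> int) set" where
  "sft m L = {x. \<forall>i. word_at x i m \<in> L}"

lemma closed_sft: "closed (sft m L)"
proof -
  have "sft m L = (\<Inter>i. {x. word_at x i m \<in> L})" by (auto simp: sft_def)
  moreover have "closed (\<Inter>i. {x. word_at x i m \<in> L})"
    by (intro closed_INT ballI clopen_word_at)
  ultimately show ?thesis by simp
qed

lemma subset_sft: "X \<subseteq> sft m (language m X)"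
  by (auto simp: sft_def word_at_in_language)

text \<open>The letters at a fixed coordinate form a continuous image of a compact set in the
  discrete space of integers.\<close>
lemma finite_letters:
  assumes "X \<in> subshifts"
  shows "finite ((\<lambda>x. x i) ` X)"
proof -
  have "compact ((\<lambda>x. x i) ` X)"
    using assms by (intro compact_continuous_image continuous_on_subset[OF continuous_on_product_coordinates])
      (auto simp: subshifts_def)
  moreover have "(\<lambda>x. x i) ` X \<subseteq> (\<Union>a\<in>(\<lambda>x. x i) ` X. {a})" by auto
  ultimately obtain C where C: "C \<subseteq> (\<lambda>x. x i) ` X" "finite C" "(\<lambda>x. x i) ` X \<subseteq> (\<Union>a\<in>C. {a})"
    using compactE_image[of "(\<lambda>x. x i) ` X" "(\<lambda>x. x i) ` X" "\<lambda>a. {a}"] open_discrete by metis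
  then show ?thesis by (auto intro: finite_subset)
qed

text \<open>Compactness comes from Tychonoff's theorem: the points of \<open>Z\<close> use only the finitely many
  letters of \<open>X\<close>, as every letter is the first one of some word of \<open>X\<close>.\<close>
lemma closed_shift_invariant_in_sft_subshift:
  assumes X: "X \<in> subshifts" and "0 < m"
    and Z: "Z \<noteq> {}" "closed Z" "Z \<subseteq> sft m (language m X)"
    and shift: "\<And>x d. x \<in> Z \<Longrightarrow> (\<lambda>i. x (i + d)) \<in> Z"
  shows "Z \<in> subshifts"
proof -
  define A where "A = (\<lambda>x. x 0) ` X"
  have "x i \<in> A" if "x \<in> Z" for x i
  proof -
    have "word_at x i m \<in> language m X" using that Z(3) by (auto simp: sft_def)
    then obtain y where y: "y \<in> X" "word_at y 0 m = word_at x i m"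
      by (rule language_at_0[OF X])
    then have "y 0 = x i" using \<open>0 < m\<close> by (auto simp: word_at_eq_iff dest: spec[of _ 0])
    then show ?thesis using y(1) unfolding A_def by (metis imageI)
  qed
  then have "Z \<subseteq> (\<Pi>\<^sub>E i\<in>UNIV. A)" by auto
  moreover have "compact ((\<Pi>\<^sub>E i\<in>UNIV. A) :: (int \<Rightarrow> int) set)"
  proof -
    have "compactin (product_topology (\<lambda>_::int. euclidean :: int topology) UNIV) (\<Pi>\<^sub>E i\<in>UNIV. A)"
      unfolding compactin_PiE using finite_letters[OF X, of 0]
      by (simp add: A_def finite_imp_compact)
    then show ?thesis by (simp add: euclidean_product_topology)
  qed
  ultimately have "compact Z"
    using compact_Int_closed[OF _ Z(2)] by (metis inf.absorb_iff2)
  moreover have "shift_map ` Z = Z"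
  proof
    show "shift_map ` Z \<subseteq> Z" using shift by (auto simp: shift_map_def)
    show "Z \<subseteq> shift_map ` Z"
    proof
      fix x assume "x \<in> Z"
      moreover have "x = shift_map (\<lambda>i. x (i + (-1)))" by (simp add: shift_map_def)
      ultimately show "x \<in> shift_map ` Z" using shift by blast
    qed
  qed
  ultimately show ?thesis using Z(1) by (simp add: subshifts_def)
qed

section \<open>Middle cycles as periodic sequences\<close>

text \<open>For the periodic sequence \<open>c\<close> of a cycle, these are the vertices of the cycle in
  the graph whose vertices are the \<open>r\<close>-letter words.\<close>
definition orbit_words :: "nat \<Rightarrow> (int \<Rightarrow> int) \<Rightarrow> int list set" where
  "orbit_words r c = range (\<lambda>i. word_at c i r)"

text \<open>A middle cycle of length \<open>q\<close> in the Rauzy graph with \<open>r\<close>-letter vertices and \<open>r + 1\<close>-letter edges,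
  encoded by the sequence of its letters instead of the list of its edges. Unlike that list,
  the sequence \<open>c\<close> makes sense at all levels at once, which allows the cycle to be lifted
  to longer Rauzy graphs. The injectivity clause says that the \<open>q\<close> vertices are distinct.\<close>
definition middle_cycle :: "(int \<Rightarrow> int) set \<Rightarrow> nat \<Rightarrow> nat \<Rightarrow> (int \<Rightarrow> int) \<Rightarrow> bool" where
  "middle_cycle X r q c \<longleftrightarrow> 0 < q \<and> (\<forall>i z. c (i + int q * z) = c i) \<and>
    (\<forall>i. word_at c i (Suc r) \<in> language (Suc r) X) \<and>
    (\<forall>i j. word_at c i r = word_at c j r \<longrightarrow> i mod int q = j mod int q) \<and>
    (\<exists>e\<in>language (Suc r) X. tl e \<in> orbit_words r c \<and> butlast e \<notin> orbit_words r c) \<and>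
    (\<exists>e\<in>language (Suc r) X. butlast e \<in> orbit_words r c \<and> tl e \<notin> orbit_words r c)"

lemma middle_cycleD:
  assumes "middle_cycle X r q c"
  shows "0 < q" "c (i + int q * z) = c i" "word_at c i (Suc r) \<in> language (Suc r) X"
    "word_at c i r = word_at c j r \<Longrightarrow> i mod int q = j mod int q"
    "\<exists>e\<in>language (Suc r) X. tl e \<in> orbit_words r c \<and> butlast e \<notin> orbit_words r c"
    "\<exists>e\<in>language (Suc r) X. butlast e \<in> orbit_words r c \<and> tl e \<notin> orbit_words r c"
  using assms unfolding middle_cycle_def by blast+

text \<open>A bi-infinite walk in a Rauzy graph is recovered from the sequence of first letters of
  its edges, because letter \<open>k\<close> of an edge is the first letter of the edge \<open>k\<close> steps later.\<close>
lemma word_at_of_overlapping_words: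
  assumes len: "\<And>i. length (W i) = Suc r"
    and overlap: "\<And>i. tl (W i) = butlast (W (i + 1))"
  shows "word_at (\<lambda>i. hd (W i)) i (Suc r) = W i"
proof -
  have "W i ! k = hd (W (i + int k))" if "k \<le> r" for i k
    using that
  proof (induction k arbitrary: i)
    case 0
    then show ?case using len[of i] by (cases "W i") auto
  next
    case (Suc k)
    have "W i ! Suc k = tl (W i) ! k" using Suc.prems len[of i] by (simp add: nth_tl)
    also have "\<dots> = W (i + 1) ! k" using Suc.prems len by (simp add: overlap nth_butlast)
    also have "\<dots> = hd (W (i + int (Suc k)))" using Suc by (simp add: add_ac)
    finally show ?case .
  qed
  then show ?thesis
    using len[of i] by (intro nth_equalityI) (auto simp: word_at_def less_Suc_eq_le simp del: upt_Suc)
qed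

lemma cas_nth:
  assumes "pre_digraph.cas G u p v" "Suc k < length p"
  shows "head G (p ! k) = tail G (p ! Suc k)"
  using assms
proof (induction p arbitrary: u k)
  case Nil
  then show ?case by simp
next
  case (Cons e p)
  then show ?case
    by (cases k; cases p) (auto simp: pre_digraph.cas.simps)
qed

lemma cas_last:
  assumes "pre_digraph.cas G u p v" "p \<noteq> []"
  shows "head G (last p) = v"
  using assms by (induction p arbitrary: u) (auto simp: pre_digraph.cas.simps split: if_splits)

lemma middle_cycle_obtain:
  assumes "\<not> no_middle_cycles (rauzy_graph X (Suc r))"
  obtains q c where "middle_cycle X r q c"
proof -
  let ?G = "rauzy_graph X (Suc r)"
  have G: "verts ?G = language r X" "arcs ?G = language (Suc r) X" "tail ?G = butlast" "head ?G = tl"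
    by (simp_all add: rauzy_graph_def)
  obtain p where cyc: "pre_digraph.cycle ?G p"
    and inc: "\<exists>e\<in>language (Suc r) X. tl e \<in> butlast ` set p \<and> butlast e \<notin> butlast ` set p"
    and out: "\<exists>e\<in>language (Suc r) X. butlast e \<in> butlast ` set p \<and> tl e \<notin> butlast ` set p"
    using assms unfolding no_middle_cycles_def Let_def G by auto
  obtain u where walk: "set p \<subseteq> language (Suc r) X" "pre_digraph.cas ?G u p u"
    and dist: "distinct (tl (pre_digraph.awalk_verts ?G u p))" and ne: "p \<noteq> []"
    using cyc unfolding pre_digraph.cycle_def pre_digraph.awalk_def G by auto
  define q where "q = length p"
  have q: "0 < q" using ne by (simp add: q_def)
  have dist: "distinct (map tl p)"
    using dist ne by (simp add: pre_digraph.awalk_verts_conv'[OF walk(2)] G)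
  \<comment> \<open>the bi-infinite walk that runs round the cycle forever\<close>
  define W where "W = (\<lambda>i. p ! nat (i mod int q))"
  define c where "c = (\<lambda>i. hd (W i))"
  have lt: "nat (i mod int q) < length p" for i using q by (simp add: q_def nat_less_iff)
  have Wp: "W i \<in> set p" for i using lt by (simp add: W_def)
  have setp: "set p = range W"
  proof
    show "range W \<subseteq> set p" using Wp by auto
    show "set p \<subseteq> range W"
    proof
      fix e assume "e \<in> set p"
      then obtain k where "k < q" "e = p ! k" by (auto simp: in_set_conv_nth q_def)
      then have "e = W (int k)" by (simp add: W_def nat_mod_as_int[symmetric])
      then show "e \<in> range W" by blast
    qed
  qed
  have len: "length (W i) = Suc r" for i
    using Wp[of i] walk(1) by (auto simp: language_def)
  have overlap: "tl (W i) = butlast (W (i + 1))" for i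
  proof (cases "i mod int q + 1 = int q")
    \<comment> \<open>the step from the last edge back to the first one uses that the walk is closed\<close>
    case True
    then have "(i + 1) mod int q = 0" by (metis mod_add_left_eq mod_self)
    moreover have "nat (i mod int q) = length p - 1" using True by (simp add: q_def)
    ultimately have "W (i + 1) = hd p" "W i = last p"
      using ne by (simp_all add: W_def hd_conv_nth last_conv_nth)
    moreover have "butlast (hd p) = u"
      using walk(2) ne by (cases p) (auto simp: pre_digraph.cas.simps G)
    ultimately show ?thesis using cas_last[OF walk(2) ne] by (simp add: G)
  next
    case False
    have b: "0 \<le> i mod int q" "i mod int q < int q" using q by simp_all
    have "(i + 1) mod int q = (i mod int q + 1) mod int q" by (simp add: mod_simps)
    also have "\<dots> = i mod int q + 1" using b False by simp
    finally have "nat ((i + 1) mod int q) = Suc (nat (i mod int q))" using b by simp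
    then show ?thesis
      using cas_nth[OF walk(2), of "nat (i mod int q)"] lt[of "i + 1"] by (simp add: W_def G)
  qed
  have W: "word_at c i (Suc r) = W i" for i
    unfolding c_def by (rule word_at_of_overlapping_words[where W = W]) (use len overlap in auto)
  have K: "orbit_words r c = butlast ` set p"
    unfolding orbit_words_def setp by (simp add: image_image W[symmetric] butlast_word_at)
  have per: "c (i + int q * z) = c i" for i z by (simp add: c_def W_def)
  have inj: "i mod int q = j mod int q" if eq: "word_at c i r = word_at c j r" for i j
  proof -
    \<comment> \<open>a cycle has distinct heads, and the vertex at \<open>i\<close> is the head of the edge before it\<close>
    have "tl (W (i - 1)) = tl (W (j - 1))"
      using eq by (simp add: W[symmetric] tl_word_at)
    then have "nat ((i - 1) mod int q) = nat ((j - 1) mod int q)"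
      using dist lt[of "i - 1"] lt[of "j - 1"] unfolding W_def
      by (metis distinct_conv_nth length_map nth_map)
    then have "(i - 1) mod int q = (j - 1) mod int q"
      using q by (metis eq_nat_nat_iff of_nat_0_less_iff pos_mod_sign)
    then have "(i - 1 + 1) mod int q = (j - 1 + 1) mod int q" by (metis mod_add_left_eq)
    then show ?thesis by simp
  qed
  have "middle_cycle X r q c"
    unfolding middle_cycle_def K
  proof (intro conjI allI impI)
    show "word_at c i (Suc r) \<in> language (Suc r) X" for i
      using walk(1) Wp[of i] unfolding W by blast
  qed (fact q per inj inc out)+
  then show thesis by (rule that)
qed

lemma cas_word_at:
  assumes "tail G = butlast" "head G = tl"
  shows "pre_digraph.cas G (word_at c i r) (map (\<lambda>k. word_at c (i + int k) (Suc r)) [0..<q])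
    (word_at c (i + int q) r)"
proof (induction q arbitrary: i)
  case 0
  then show ?case by (simp add: pre_digraph.cas.simps)
next
  case (Suc q)
  show ?case
    using Suc[of "i + 1"]
    by (simp add: upt_conv_Cons map_Suc_upt[symmetric] pre_digraph.cas.simps assms butlast_word_at
        tl_word_at comp_def add_ac del: upt_Suc)
qed

lemma middle_cycle_not_nmc:
  assumes "middle_cycle X r q c"
  shows "\<not> no_middle_cycles (rauzy_graph X (Suc r))"
proof -
  let ?G = "rauzy_graph X (Suc r)"
  have G: "verts ?G = language r X" "arcs ?G = language (Suc r) X" "tail ?G = butlast" "head ?G = tl"
    by (simp_all add: rauzy_graph_def)
  have q: "0 < q" and per: "\<And>i z. c (i + int q * z) = c i"
    and lang: "\<And>i. word_at c i (Suc r) \<in> language (Suc r) X"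
    and inj: "\<And>i j. word_at c i r = word_at c j r \<Longrightarrow> i mod int q = j mod int q"
    and io: "\<exists>e\<in>language (Suc r) X. tl e \<in> orbit_words r c \<and> butlast e \<notin> orbit_words r c"
      "\<exists>e\<in>language (Suc r) X. butlast e \<in> orbit_words r c \<and> tl e \<notin> orbit_words r c"
    using middle_cycleD[OF assms] by blast+
  define p where "p = map (\<lambda>k. word_at c (int k) (Suc r)) [0..<q]"
  have per': "word_at c (i + int q * z) m = word_at c i m" for i z m
  proof -
    have "c (i + int q * z + int k) = c (i + int k)" for k
      using per[of "i + int k" z] by (simp add: add_ac)
    then show ?thesis by (simp add: word_at_eq_iff)
  qed
  have cas: "pre_digraph.cas ?G (word_at c 0 r) p (word_at c 0 r)"
    using cas_word_at[OF G(3,4), of c 0 r q] per'[of 0 1 r] by (simp add: p_def)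
  have v: "word_at c 0 r \<in> language r X"
  proof -
    obtain x i where "x \<in> X" "word_at c 0 (Suc r) = word_at x i (Suc r)"
      using lang[of 0] unfolding language_def by blast
    then show ?thesis by (metis butlast_word_at word_at_in_language)
  qed
  have "distinct (map tl p)"
  proof -
    have "k = l" if "k < q" "l < q" "word_at c (int k + 1) r = word_at c (int l + 1) r" for k l
    proof -
      have "(int k + 1 - 1) mod int q = (int l + 1 - 1) mod int q"
        using inj[OF that(3)] by (metis mod_diff_left_eq)
      then show ?thesis using that(1,2) by simp
    qed
    then show ?thesis
      unfolding p_def by (auto simp: distinct_map inj_on_def tl_word_at)
  qed
  moreover have "tl (pre_digraph.awalk_verts ?G (word_at c 0 r) p) = map tl p"
  proof -
    have "p \<noteq> []" using q by (simp add: p_def)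
    then show ?thesis by (simp add: pre_digraph.awalk_verts_conv'[OF cas] G)
  qed
  ultimately have "pre_digraph.cycle ?G p"
    unfolding pre_digraph.cycle_def pre_digraph.awalk_def
    using cas v q lang
    by (intro exI[of _ "word_at c 0 r"]) (auto simp: G p_def)
  moreover have "butlast ` set p = orbit_words r c"
  proof -
    have "word_at c i r \<in> (\<lambda>k. word_at c (int k) r) ` {0..<q}" for i
    proof
      show "word_at c i r = word_at c (int (nat (i mod int q))) r"
        using per'[of "i mod int q" "i div int q" r] q by simp
      show "nat (i mod int q) \<in> {0..<q}" using q by (simp add: nat_less_iff)
    qed
    then show ?thesis
      unfolding orbit_words_def p_def by (auto simp: image_image butlast_word_at)
  qed
  ultimately show ?thesis
    unfolding no_middle_cycles_def Let_def G not_not using io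
    by (intro exI[of _ p] conjI) simp_all
qed


section \<open>Points that enter the cycle once and for all\<close>

text \<open>Concatenation of walks: the past of \<open>x\<close> followed by the future of \<open>z\<close>. It stays in the shift of
  finite type if both walks are at the same vertex at time \<open>i\<close>, since the agreement on \<open>r\<close>
  letters makes every window of \<open>r + 1\<close> letters fall into \<open>x\<close> or into \<open>z\<close>.\<close>
definition splice :: "(int \<Rightarrow> int) \<Rightarrow> int \<Rightarrow> (int \<Rightarrow> int) \<Rightarrow> (int \<Rightarrow> int)" where
  "splice x i z = (\<lambda>k. if k < i then x k else z k)"

lemma splice_right: "i \<le> k \<Longrightarrow> splice x i z k = z k"
  by (simp add: splice_def)

lemma splice_left:
  assumes "word_at x i r = word_at z i r" "k < i + int r"
  shows "splice x i z k = x k"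
proof (cases "k < i")
  case False
  then have "nat (k - i) < r" "i + int (nat (k - i)) = k" using assms(2) by auto
  then have "x k = z k" using assms(1) unfolding word_at_eq_iff by metis
  then show ?thesis by (simp add: splice_def)
qed (simp add: splice_def)

lemma splice_in_sft:
  assumes "x \<in> sft (Suc r) L" "z \<in> sft (Suc r) L" "word_at x i r = word_at z i r"
  shows "splice x i z \<in> sft (Suc r) L"
  unfolding sft_def
proof (intro CollectI allI)
  fix k
  show "word_at (splice x i z) k (Suc r) \<in> L"
  proof (cases "k < i")
    case True
    then have "word_at (splice x i z) k (Suc r) = word_at x k (Suc r)"
      by (simp add: word_at_eq_iff splice_left[OF assms(3)])
    then show ?thesis using assms(1) by (simp add: sft_def)
  next
    case False
    then have "word_at (splice x i z) k (Suc r) = word_at z k (Suc r)"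
      by (simp add: word_at_eq_iff splice_right)
    then show ?thesis using assms(2) by (simp add: sft_def)
  qed
qed

lemma sft_shift: "x \<in> sft m L \<Longrightarrow> (\<lambda>k. x (k + d)) \<in> sft m L"
  by (simp add: sft_def word_at_shift)

lemma orbit_words_shiftD:
  assumes "word_at x j r \<in> orbit_words r c"
  obtains d where "word_at x j r = word_at (\<lambda>k. c (k + d)) j r"
proof -
  obtain a where "word_at x j r = word_at c a r" using assms by (auto simp: orbit_words_def)
  then have "word_at x j r = word_at (\<lambda>k. c (k + (a - j))) j r"
    by (simp only: word_at_shift) simp
  then show thesis by (rule that)
qed

text \<open>From its first visit to \<open>K\<close> at a positive time on, the walk \<open>x\<close> is replaced by a shift of \<open>c\<close> that
  passes the same vertex at that time. Time 0 is left out so that the edge from time 0 to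
  time 1 survives even when it starts in \<open>K\<close>.\<close>
lemma redirect_future:
  assumes c: "c \<in> sft (Suc r) L" and x: "x \<in> sft (Suc r) L"
  obtains y where "y \<in> sft (Suc r) L" "\<And>k. k \<le> int r \<Longrightarrow> y k = x k"
    "\<And>j. 0 < j \<Longrightarrow> word_at y j r \<in> orbit_words r c \<Longrightarrow> \<exists>d. \<forall>k\<ge>j. y k = c (k + d)"
proof (cases "\<exists>n. word_at x (int n + 1) r \<in> orbit_words r c")
  case False
  have "word_at x j r \<notin> orbit_words r c" if "0 < j" for j
    using False[simplified, rule_format, of "nat (j - 1)"] that by simp
  then show ?thesis using that[of x] x by blast
next
  case True
  define n where "n = (LEAST n. word_at x (int n + 1) r \<in> orbit_words r c)"
  define i where "i = int n + 1"
  have i: "0 < i" "word_at x i r \<in> orbit_words r c"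
    using LeastI_ex[OF True] by (simp_all add: i_def n_def)
  have first: "word_at x j r \<notin> orbit_words r c" if "0 < j" "j < i" for j
  proof -
    have "nat (j - 1) < n" using that by (simp add: i_def)
    then have "word_at x (int (nat (j - 1)) + 1) r \<notin> orbit_words r c"
      unfolding n_def by (rule not_less_Least)
    then show ?thesis using that by simp
  qed
  obtain d where d: "word_at x i r = word_at (\<lambda>k. c (k + d)) i r"
    using i(2) by (rule orbit_words_shiftD)
  define y where "y = splice x i (\<lambda>k. c (k + d))"
  have left: "y k = x k" if "k < i + int r" for k
    unfolding y_def using d that by (rule splice_left)
  show ?thesis
  proof (rule that[of y])
    show "y \<in> sft (Suc r) L" unfolding y_def by (intro splice_in_sft x sft_shift c d)
    show "y k = x k" if "k \<le> int r" for k using left[of k] that i(1) by simp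
    show "\<exists>d. \<forall>k\<ge>j. y k = c (k + d)" if "0 < j" "word_at y j r \<in> orbit_words r c" for j
    proof -
      have "i \<le> j"
      proof (rule ccontr)
        assume "\<not> i \<le> j"
        then have "word_at y j r = word_at x j r" by (simp add: word_at_eq_iff left)
        then show False using first that \<open>\<not> i \<le> j\<close> by simp
      qed
      then show ?thesis by (intro exI[of _ d]) (simp add: y_def splice_right)
    qed
  qed
qed

text \<open>The mirror image: the walk is replaced before its last visit to \<open>K\<close> at a time \<open>j \<le> 0\<close>. The
  vertex at time \<open>j\<close> occupies the coordinates up to \<open>j + r - 1\<close>, whence the bound.\<close>
lemma redirect_past:
  assumes c: "c \<in> sft (Suc r) L" and x: "x \<in> sft (Suc r) L"
  obtains y where "y \<in> sft (Suc r) L" "\<And>k. 0 \<le> k \<Longrightarrow> y k = x k"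
    "\<And>j. j \<le> 0 \<Longrightarrow> word_at y j r \<in> orbit_words r c \<Longrightarrow> \<exists>d. \<forall>k<j + int r. y k = c (k + d)"
proof (cases "\<exists>n. word_at x (- int n) r \<in> orbit_words r c")
  case False
  have "word_at x j r \<notin> orbit_words r c" if "j \<le> 0" for j
    using False[simplified, rule_format, of "nat (- j)"] that by simp
  then show ?thesis using that[of x] x by blast
next
  case True
  define n where "n = (LEAST n. word_at x (- int n) r \<in> orbit_words r c)"
  define i where "i = - int n"
  have i: "i \<le> 0" "word_at x i r \<in> orbit_words r c"
    using LeastI_ex[OF True] by (simp_all add: i_def n_def)
  have last: "word_at x j r \<notin> orbit_words r c" if "j \<le> 0" "i < j" for j
  proof -
    have "nat (- j) < n" using that by (simp add: i_def)
    then have "word_at x (- int (nat (- j))) r \<notin> orbit_words r c"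
      unfolding n_def by (rule not_less_Least)
    then show ?thesis using that by simp
  qed
  obtain d where d: "word_at x i r = word_at (\<lambda>k. c (k + d)) i r"
    using i(2) by (rule orbit_words_shiftD)
  define y where "y = splice (\<lambda>k. c (k + d)) i x"
  have right: "y k = x k" if "i \<le> k" for k
    unfolding y_def using that by (rule splice_right)
  show ?thesis
  proof (rule that[of y])
    show "y \<in> sft (Suc r) L" unfolding y_def by (intro splice_in_sft x sft_shift c d[symmetric])
    show "y k = x k" if "0 \<le> k" for k using right[of k] that i(1) by simp
    show "\<exists>d. \<forall>k<j + int r. y k = c (k + d)"
      if "j \<le> 0" "word_at y j r \<in> orbit_words r c" for j
    proof -
      have "j \<le> i"
      proof (rule ccontr)
        assume "\<not> j \<le> i"
        then have "word_at y j r = word_at x j r" by (simp add: word_at_eq_iff right)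
        then show False using last that \<open>\<not> j \<le> i\<close> by simp
      qed
      then have "y k = c (k + d)" if "k < j + int r" for k
        unfolding y_def using that by (intro splice_left[OF d[symmetric]]) simp
      then show ?thesis by blast
    qed
  qed
qed

definition enters_for_good :: "nat \<Rightarrow> int list set \<Rightarrow> (int \<Rightarrow> int) \<Rightarrow> bool" where
  "enters_for_good r K x \<longleftrightarrow> (\<forall>i j k. i < j \<longrightarrow> j < k \<longrightarrow>
    word_at x i r \<notin> K \<longrightarrow> word_at x j r \<in> K \<longrightarrow> word_at x k r \<in> K)"

text \<open>Each instance of the condition involves three words only, so it is clopen.\<close>
lemma closed_enters_for_good: "closed {x. enters_for_good r K x}"
proof -
  have *: "closed {x. word_at x i r \<in> K}" "open {x. word_at x i r \<in> K}" "open {x. word_at x i r \<notin> K}" for i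
    by (rule clopen_word_at)+
  show ?thesis
    unfolding enters_for_good_def
    by (intro closed_Collect_all closed_Collect_imp open_Collect_const *)
qed

lemma enters_for_good_shift:
  assumes "enters_for_good r K x"
  shows "enters_for_good r K (\<lambda>k. x (k + d))"
  unfolding enters_for_good_def word_at_shift
proof (intro allI impI)
  fix i j k :: int assume "i < j" "j < k" "word_at x (i + d) r \<notin> K" "word_at x (j + d) r \<in> K"
  moreover have "i + d < j + d" "j + d < k + d" using \<open>i < j\<close> \<open>j < k\<close> by simp_all
  ultimately show "word_at x (k + d) r \<in> K"
    using assms unfolding enters_for_good_def by blast
qed

text \<open>After both redirections the visits of \<open>y\<close> to \<open>K\<close> form an initial and a final stretch of time: a
  visit at a time \<open>j \<le> 0\<close> forces \<open>y\<close> to have been in \<open>K\<close> all the time before, and a visit at a time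
  \<open>j > 0\<close> forces it to stay in \<open>K\<close>. Such a walk may leave \<open>K\<close> and come back, but it cannot enter and
  leave again. The last two conclusions record that \<open>y\<close> really follows the cycle there; being in
  \<open>K\<close> alone would permit chords of the cycle.\<close>
lemma point_through_word:
  assumes c: "c \<in> sft (Suc r) L" and x: "x \<in> sft (Suc r) L"
  obtains y where "y \<in> sft (Suc r) L" "word_at y 0 (Suc r) = word_at x 0 (Suc r)"
    "enters_for_good r (orbit_words r c) y"
    "word_at y 1 r \<in> orbit_words r c \<Longrightarrow> \<exists>d. \<forall>k\<ge>1. y k = c (k + d)"
    "word_at y 0 r \<in> orbit_words r c \<Longrightarrow> \<exists>d. \<forall>k<int r. y k = c (k + d)"
proof -
  obtain z where z: "z \<in> sft (Suc r) L" "\<And>k. k \<le> int r \<Longrightarrow> z k = x k"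
    "\<And>j. 0 < j \<Longrightarrow> word_at z j r \<in> orbit_words r c \<Longrightarrow> \<exists>d. \<forall>k\<ge>j. z k = c (k + d)"
    by (rule redirect_future[OF c x]) (rule that, assumption, blast, blast)
  obtain y where y: "y \<in> sft (Suc r) L" "\<And>k. 0 \<le> k \<Longrightarrow> y k = z k"
    "\<And>j. j \<le> 0 \<Longrightarrow> word_at y j r \<in> orbit_words r c \<Longrightarrow> \<exists>d. \<forall>k<j + int r. y k = c (k + d)"
    by (rule redirect_past[OF c z(1)]) (rule that, assumption, blast, blast)
  have future: "\<exists>d. \<forall>k\<ge>j. y k = c (k + d)" if "0 < j" "word_at y j r \<in> orbit_words r c" for j
  proof -
    have "word_at z j r = word_at y j r" using that(1) by (simp add: word_at_eq_iff y(2))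
    then have "word_at z j r \<in> orbit_words r c" using that(2) by simp
    then obtain d where "\<forall>k\<ge>j. z k = c (k + d)" using z(3)[OF \<open>0 < j\<close>] by blast
    then show ?thesis using y(2) that(1) by (intro exI[of _ d]) simp
  qed
  have word: "word_at (\<lambda>k. c (k + d)) j r \<in> orbit_words r c" for d j
    unfolding word_at_shift orbit_words_def by blast
  have good: "enters_for_good r (orbit_words r c) y"
    unfolding enters_for_good_def
  proof (intro allI impI)
    fix i j k :: int
    assume less: "i < j" "j < k"
      and i: "word_at y i r \<notin> orbit_words r c" and j: "word_at y j r \<in> orbit_words r c"
    have "0 < j"
    proof (rule ccontr)
      assume "\<not> 0 < j"
      then obtain d where "\<forall>k<j + int r. y k = c (k + d)" using y(3) j by force
      then have "word_at y i r = word_at (\<lambda>k. c (k + d)) i r"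
        using less(1) by (simp add: word_at_eq_iff)
      then show False using i word[of d i] by simp
    qed
    then obtain d where "\<forall>k\<ge>j. y k = c (k + d)" using future j by blast
    then have "word_at y k r = word_at (\<lambda>k. c (k + d)) k r"
      using less(2) by (simp add: word_at_eq_iff)
    then show "word_at y k r \<in> orbit_words r c" using word[of d k] by simp
  qed
  show thesis
  proof (rule that[OF y(1) _ good])
    show "word_at y 0 (Suc r) = word_at x 0 (Suc r)" by (simp add: word_at_eq_iff y(2) z(2))
    show "\<exists>d. \<forall>k\<ge>1. y k = c (k + d)" if "word_at y 1 r \<in> orbit_words r c"
      using future[of 1] that by simp
    show "\<exists>d. \<forall>k<int r. y k = c (k + d)" if "word_at y 0 r \<in> orbit_words r c"
      using y(3)[of 0] that by simp
  qed
qed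

section \<open>Middle cycles persist in all longer Rauzy graphs\<close>

text \<open>Two shifts of a periodic sequence can be aligned at arbitrarily late times.\<close>
lemma later_occurrence:
  assumes "0 < q" "\<And>i z. c (i + int q * z) = c i"
  obtains p where "p0 \<le> p" "\<And>k. c (p + d + k) = c (i + k)"
proof
  show "p0 \<le> p0 + (i - d - p0) mod int q" using assms(1) by simp
  have *: "p0 + (i - d - p0) mod int q + d + k = i + k + int q * (- ((i - d - p0) div int q))" for k
    using mult_div_mod_eq[of "int q" "i - d - p0"] unfolding mult_minus_right by linarith
  show "c (p0 + (i - d - p0) mod int q + d + k) = c (i + k)" for k
    unfolding * by (rule assms(2))
qed

text \<open>The point \<open>u\<close> passes from outside of \<open>K\<close> into \<open>c\<close>, and \<open>v\<close> passes from \<open>c\<close> out of \<open>K\<close>. At any later level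
  \<open>m\<close> the words of \<open>c\<close> occur in \<open>u\<close>, and they still form a cycle because distinct prefixes make
  words distinct. The word of \<open>u\<close> at 0 is an incoming edge: its tail begins with a vertex outside
  of \<open>K\<close>. For an outgoing edge take the word of \<open>v\<close> that ends with the vertex outside of \<open>K\<close>, that
  is, the one starting at \<open>r - m\<close>.\<close>
lemma middle_cycle_longer_words:
  assumes mc: "middle_cycle X r q c" and "r \<le> m"
    and u: "u \<in> Z" "word_at u 0 r \<notin> orbit_words r c" "\<And>k. 1 \<le> k \<Longrightarrow> u k = c (k + d)"
    and v: "v \<in> Z" "word_at v 1 r \<notin> orbit_words r c" "\<And>k. k < int r \<Longrightarrow> v k = c (k + d')"
  shows "middle_cycle Z m q c"
proof -
  note mcD = middle_cycleD[OF mc]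
  have prefix: "word_at x i r = word_at c j r" if "word_at x i m = word_at c j m" for x i j
    using that \<open>r \<le> m\<close> by (auto simp: word_at_eq_iff)
  have lang: "word_at c i (Suc m) \<in> language (Suc m) Z" for i
  proof -
    obtain p where p: "1 \<le> p" "\<And>k. c (p + d + k) = c (i + k)"
      using later_occurrence[of q c 1 d i] mcD(1,2) by metis
    then have "word_at c i (Suc m) = word_at u p (Suc m)"
      by (simp add: word_at_eq_iff u(3) p(2)[symmetric] add_ac)
    then show ?thesis using word_at_in_language[OF u(1)] by metis
  qed
  have enter: "\<exists>e\<in>language (Suc m) Z. tl e \<in> orbit_words m c \<and> butlast e \<notin> orbit_words m c"
  proof (intro bexI conjI)
    show "word_at u 0 (Suc m) \<in> language (Suc m) Z" by (rule word_at_in_language[OF u(1)])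
    have "word_at u 1 m = word_at c (1 + d) m" by (simp add: word_at_eq_iff u(3) add_ac)
    then show "tl (word_at u 0 (Suc m)) \<in> orbit_words m c"
      by (simp add: tl_word_at orbit_words_def)
    show "butlast (word_at u 0 (Suc m)) \<notin> orbit_words m c"
      using u(2) prefix unfolding butlast_word_at orbit_words_def by blast
  qed
  have leave: "\<exists>e\<in>language (Suc m) Z. butlast e \<in> orbit_words m c \<and> tl e \<notin> orbit_words m c"
  proof (intro bexI conjI)
    let ?i = "int r - int m"
    show "word_at v ?i (Suc m) \<in> language (Suc m) Z" by (rule word_at_in_language[OF v(1)])
    have "word_at v ?i m = word_at c (?i + d') m"
      by (simp add: word_at_eq_iff v(3) add_ac)
    then show "butlast (word_at v ?i (Suc m)) \<in> orbit_words m c"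
      by (simp add: butlast_word_at orbit_words_def)
    show "tl (word_at v ?i (Suc m)) \<notin> orbit_words m c"
    proof
      assume "tl (word_at v ?i (Suc m)) \<in> orbit_words m c"
      then obtain j where j: "word_at v (?i + 1) m = word_at c j m"
        by (auto simp: tl_word_at orbit_words_def)
      have "v (1 + int k) = c (j + int (m - r) + int k)" if "k < r" for k
      proof -
        have "m - r + k < m" using that \<open>r \<le> m\<close> by simp
        then have "v (?i + 1 + int (m - r + k)) = c (j + int (m - r + k))"
          using j unfolding word_at_eq_iff by blast
        moreover have "?i + 1 + int (m - r + k) = 1 + int k"
          "j + int (m - r + k) = j + int (m - r) + int k"
          using \<open>r \<le> m\<close> by simp_all
        ultimately show ?thesis by metis
      qed
      then have "word_at v 1 r = word_at c (j + int (m - r)) r" by (simp add: word_at_eq_iff)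
      then show False using v(2) by (simp add: orbit_words_def)
    qed
  qed
  show ?thesis
    unfolding middle_cycle_def
    using mcD(1,2) mcD(4)[OF prefix] lang enter leave by blast
qed

text \<open>Levels up to \<open>r + 1\<close> are inherited from \<open>X\<close>, and all later ones are covered by the lifted cycle.\<close>
lemma not_NMC_if_asymptotic_to_cycle:
  assumes X: "X \<in> subshifts - NMC_subshifts" and mc: "middle_cycle X r q c"
    and lang: "language (Suc r) Z = language (Suc r) X"
    and u: "u \<in> Z" "word_at u 0 r \<notin> orbit_words r c" "\<And>k. 1 \<le> k \<Longrightarrow> u k = c (k + d)"
    and v: "v \<in> Z" "word_at v 1 r \<notin> orbit_words r c" "\<And>k. k < int r \<Longrightarrow> v k = c (k + d')"
  shows "Z \<notin> NMC_subshifts"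
proof
  assume "Z \<in> NMC_subshifts"
  then obtain n where n: "2 \<le> n" "no_middle_cycles (rauzy_graph Z n)"
    by (auto simp: NMC_subshifts_def)
  show False
  proof (cases "n \<le> Suc r")
    case True
    then have "language n Z = language n X" "language (n - 1) Z = language (n - 1) X"
      using language_eq_mono[OF lang] by simp_all
    then have "rauzy_graph Z n = rauzy_graph X n" by (simp add: rauzy_graph_def)
    then show False using n X by (auto simp: NMC_subshifts_def)
  next
    case False
    then obtain m where m: "n = Suc m" "r \<le> m" by (cases n) auto
    have "middle_cycle Z m q c" using middle_cycle_longer_words[OF mc m(2) u v] .
    then show False using middle_cycle_not_nmc n(2) m(1) by blast
  qed
qed

section \<open>Approximating a non-NMC subshift\<close>

text \<open>Both \<open>S\<close> and \<open>T\<close> qualify up to the condition of differing from \<open>X\<close>, and as they differ from each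
  other, one of them meets it too. Facts common to both are shown for any \<open>Z\<close> between \<open>T\<close> and \<open>S\<close>.\<close>
lemma approximation_by_other_non_NMC:
  assumes X: "X \<in> subshifts - NMC_subshifts" and "1 \<le> r"
  obtains Y where "Y \<in> subshifts - NMC_subshifts" "Y \<noteq> X" "language (Suc r) Y = language (Suc r) X"
proof -
  have XS: "X \<in> subshifts" using X by simp
  have "\<not> no_middle_cycles (rauzy_graph X (Suc r))"
  proof
    assume "no_middle_cycles (rauzy_graph X (Suc r))"
    then have "X \<in> NMC_subshifts"
      using XS \<open>1 \<le> r\<close> unfolding NMC_subshifts_def by (auto intro!: exI[of _ "Suc r"])
    then show False using X by simp
  qed
  then obtain q c where mc: "middle_cycle X r q c" by (rule middle_cycle_obtain)
  note mcD = middle_cycleD[OF mc]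
  define L where "L = language (Suc r) X"
  define K where "K = orbit_words r c"
  define S where "S = sft (Suc r) L"
  define T where "T = {x \<in> S. enters_for_good r K x}"
  have c: "c \<in> sft (Suc r) L" using mcD(3) by (simp add: sft_def L_def)
  have through: "\<exists>y\<in>T. word_at y 0 (Suc r) = w \<and>
      (word_at y 1 r \<in> K \<longrightarrow> (\<exists>d. \<forall>k\<ge>1. y k = c (k + d))) \<and>
      (word_at y 0 r \<in> K \<longrightarrow> (\<exists>d. \<forall>k<int r. y k = c (k + d)))" if "w \<in> L" for w
  proof -
    obtain x where x: "x \<in> X" "word_at x 0 (Suc r) = w"
      using \<open>w \<in> L\<close> unfolding L_def by (rule language_at_0[OF XS])
    have "x \<in> sft (Suc r) L" using x(1) subset_sft unfolding L_def by blast
    from point_through_word[OF c this] x(2) show ?thesis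
      unfolding T_def S_def K_def by (metis (mono_tags, lifting) mem_Collect_eq)
  qed
  obtain e where e: "e \<in> L" "tl e \<in> K" "butlast e \<notin> K"
    using mcD(5) unfolding L_def K_def by blast
  obtain u where u: "u \<in> T" "word_at u 0 (Suc r) = e"
      "word_at u 1 r \<in> K \<longrightarrow> (\<exists>d. \<forall>k\<ge>1. u k = c (k + d))"
    using through[OF e(1)] by blast
  have u0: "word_at u 0 r \<notin> K" using e(3) by (simp add: u(2)[symmetric] butlast_word_at)
  have "word_at u 1 r \<in> K" using e(2) by (simp add: u(2)[symmetric] tl_word_at)
  then obtain d where d: "\<And>k. 1 \<le> k \<Longrightarrow> u k = c (k + d)" using u(3) by blast
  obtain f where f: "f \<in> L" "butlast f \<in> K" "tl f \<notin> K"
    using mcD(6) unfolding L_def K_def by blast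
  obtain v where v: "v \<in> T" "word_at v 0 (Suc r) = f"
      "word_at v 0 r \<in> K \<longrightarrow> (\<exists>d. \<forall>k<int r. v k = c (k + d))"
    using through[OF f(1)] by blast
  have v1: "word_at v 1 r \<notin> K" using f(3) by (simp add: v(2)[symmetric] tl_word_at)
  have "word_at v 0 r \<in> K" using f(2) by (simp add: v(2)[symmetric] butlast_word_at)
  then obtain d' where d': "\<And>k. k < int r \<Longrightarrow> v k = c (k + d')" using v(3) by blast
  have "T \<subseteq> S" by (auto simp: T_def)
  have LZ: "language (Suc r) Z = L" if "T \<subseteq> Z" "Z \<subseteq> S" for Z
  proof
    show "language (Suc r) Z \<subseteq> L" using that(2) by (auto simp: language_def S_def sft_def)
    show "L \<subseteq> language (Suc r) Z"
    proof
      fix w assume "w \<in> L"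
      then obtain y where "y \<in> T" "word_at y 0 (Suc r) = w" using through by blast
      then show "w \<in> language (Suc r) Z" using that(1) word_at_in_language by blast
    qed
  qed
  have sub: "Z \<in> subshifts" if "T \<subseteq> Z" "Z \<subseteq> S" "closed Z"
    "\<And>x d. x \<in> Z \<Longrightarrow> (\<lambda>k. x (k + d)) \<in> Z" for Z
    using that u(1)
    by (intro closed_shift_invariant_in_sft_subshift[OF XS, of "Suc r"]) (auto simp: S_def L_def)
  have nonNMC: "Z \<notin> NMC_subshifts" if "T \<subseteq> Z" "Z \<subseteq> S" for Z
  proof (rule not_NMC_if_asymptotic_to_cycle[OF X mc])
    show "language (Suc r) Z = language (Suc r) X" using LZ[OF that] by (simp add: L_def)
    show "u \<in> Z" "v \<in> Z" using u(1) v(1) that(1) by blast+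
  qed (use u0 v1 d d' in \<open>simp_all add: K_def\<close>)
  have "S \<in> subshifts"
    using \<open>T \<subseteq> S\<close> by (intro sub) (auto simp: S_def closed_sft sft_shift)
  moreover have "T \<in> subshifts"
  proof (rule sub)
    have "T = S \<inter> {x. enters_for_good r K x}" by (auto simp: T_def)
    then show "closed T"
      using closed_Int[OF closed_sft closed_enters_for_good] by (simp add: S_def)
    show "(\<lambda>k. x (k + d)) \<in> T" if "x \<in> T" for x d
      using that by (simp add: T_def S_def sft_shift enters_for_good_shift)
  qed (use \<open>T \<subseteq> S\<close> in auto)
  moreover have "S \<noteq> T"
  proof -
    obtain p where p: "1 \<le> p" "\<And>k. c (p + d + k) = c (d' + k)"
      using later_occurrence[of q c 1 d d'] mcD(1,2) by metis
    \<comment> \<open>delay \<open>v\<close> so that its last vertex in \<open>K\<close> meets the walk \<open>u\<close> running round the cycle\<close>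
    define z where "z = (\<lambda>k. v (k + (- p)))"
    have meet: "word_at u p r = word_at z p r"
    proof -
      have "u (p + int k) = z (p + int k)" if "k < r" for k
        using that p(1) p(2)[of "int k"] by (simp add: z_def d d' add_ac)
      then show ?thesis by (simp add: word_at_eq_iff)
    qed
    define y where "y = splice u p z"
    have left: "word_at y i r = word_at u i r" if "i \<le> p" for i
      using that by (simp add: word_at_eq_iff y_def splice_left[OF meet])
    have right: "word_at y (p + 1) r = word_at v 1 r"
      by (simp add: word_at_eq_iff y_def splice_right z_def)
    have "u \<in> S" "v \<in> S" using u(1) v(1) \<open>T \<subseteq> S\<close> by blast+
    then have "u \<in> sft (Suc r) L" "z \<in> sft (Suc r) L"
      unfolding S_def z_def by (blast intro: sft_shift)+
    then have "y \<in> S"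
      unfolding y_def S_def using meet by (rule splice_in_sft)
    moreover have "\<not> enters_for_good r K y"
    proof
      assume *: "enters_for_good r K y"
      have "word_at u p r = word_at c (p + d) r"
        using p(1) by (simp add: word_at_eq_iff d add_ac)
      then have "word_at y p r \<in> K" by (simp add: left K_def orbit_words_def)
      moreover have "word_at y 0 r \<notin> K" using u0 p(1) by (simp add: left)
      ultimately have "word_at y (p + 1) r \<in> K"
        using * p(1) unfolding enters_for_good_def by (metis less_add_one zero_less_one order_less_le_trans)
      then show False using v1 by (simp add: right)
    qed
    ultimately show ?thesis by (auto simp: T_def)
  qed
  moreover have "language (Suc r) S = language (Suc r) X" "language (Suc r) T = language (Suc r) X"
    using LZ \<open>T \<subseteq> S\<close> by (simp_all add: L_def)
  moreover have "S \<notin> NMC_subshifts" "T \<notin> NMC_subshifts"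
    using nonNMC \<open>T \<subseteq> S\<close> by simp_all
  ultimately show thesis using that[of S] that[of T] by blast
qed

section \<open>Nearby subshifts\<close>

lemma language_eq_if_subshift_dist_less:
  assumes "subshift_dist X Y < 2 powr - real n"
  shows "language n X = language n Y"
proof (rule ccontr)
  assume *: "language n X \<noteq> language n Y"
  then have "Inf {n. language n X \<noteq> language n Y} \<le> n" by (intro wellorder_Inf_le1) simp
  then have "(2::real) powr - real n \<le> 2 powr - real (Inf {n. language n X \<noteq> language n Y})" by simp
  also have "\<dots> = subshift_dist X Y" using * by (auto simp: subshift_dist_def)
  finally show False using assms by simp
qed

lemma subshift_dist_less_if_language_eq:
  assumes "X \<in> subshifts" "Y \<in> subshifts" "language n X = language n Y"
  shows "subshift_dist X Y < 2 powr - real n"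
proof (cases "X = Y")
  case False
  define N where "N = Inf {n. language n X \<noteq> language n Y}"
  have "\<exists>n. language n X \<noteq> language n Y" using assms False subshift_eqI by metis
  then have "N \<in> {n. language n X \<noteq> language n Y}" unfolding N_def by (intro Inf_nat_def1) auto
  then have "n < N" using language_eq_mono[OF assms(3), of N] by (meson mem_Collect_eq not_le)
  then show ?thesis using False by (simp add: subshift_dist_def N_def)
qed (simp add: subshift_dist_def)

text \<open>The radius \<open>2 powr - n\<close> is small enough to fix the words of lengths \<open>n\<close> and \<open>n - 1\<close>, hence the Rauzy
  graph at level \<open>n\<close>.\<close>
lemma openin_NMC: "openin subshift.mtopology NMC_subshifts"
  unfolding subshift.openin_mtopology
proof (intro conjI allI impI)
  show "NMC_subshifts \<subseteq> subshifts" by (auto simp: NMC_subshifts_def)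
  fix X assume "X \<in> NMC_subshifts"
  then obtain n where n: "2 \<le> n" "no_middle_cycles (rauzy_graph X n)" by (auto simp: NMC_subshifts_def)
  have "subshift.mball X (2 powr - real n) \<subseteq> NMC_subshifts"
  proof
    fix Y assume "Y \<in> subshift.mball X (2 powr - real n)"
    then have Y: "Y \<in> subshifts" and eq: "language n X = language n Y"
      using language_eq_if_subshift_dist_less by simp_all
    have "rauzy_graph X n = rauzy_graph Y n"
      using eq language_eq_mono[OF eq, of "n - 1"] by (simp add: rauzy_graph_def)
    then show "Y \<in> NMC_subshifts" using n Y by (auto simp: NMC_subshifts_def)
  qed
  then show "\<exists>\<epsilon>>0. subshift.mball X \<epsilon> \<subseteq> NMC_subshifts"
    by (intro exI[of _ "2 powr - real n"]) simp
qed

theorem theorem4p2: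
  shows "perfect_in subshift.mtopology (subshifts - NMC_subshifts)"
  unfolding perfect_in_def
proof (intro conjI ballI notI)
  have "subshifts - (subshifts - NMC_subshifts) = NMC_subshifts" by (auto simp: NMC_subshifts_def)
  then show "closedin subshift.mtopology (subshifts - NMC_subshifts)"
    using openin_NMC by (simp add: closedin_def)
next
  fix X assume X: "X \<in> subshifts - NMC_subshifts"
    and "openin (subtopology subshift.mtopology (subshifts - NMC_subshifts)) {X}"
  then obtain U where U: "openin subshift.mtopology U" "{X} = U \<inter> (subshifts - NMC_subshifts)"
    unfolding openin_subtopology by blast
  then obtain \<epsilon> where \<epsilon>: "0 < \<epsilon>" "subshift.mball X \<epsilon> \<subseteq> U"
    unfolding subshift.openin_mtopology by blast
  obtain n where n: "(1/2) ^ n < \<epsilon>" using real_arch_pow_inv[OF \<epsilon>(1), of "1/2"] by auto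
  obtain Y where Y: "Y \<in> subshifts - NMC_subshifts" "Y \<noteq> X"
    "language (Suc (Suc n)) Y = language (Suc (Suc n)) X"
    using approximation_by_other_non_NMC[OF X, of "Suc n"] by auto
  have "language n X = language n Y" using language_eq_mono[OF Y(3), of n] by simp
  then have "subshift_dist X Y < 2 powr - real n"
    using X Y(1) by (intro subshift_dist_less_if_language_eq) auto
  also have "\<dots> = (1/2) ^ n" by (simp add: powr_minus powr_realpow power_divide divide_simps)
  finally have "Y \<in> subshift.mball X \<epsilon>" using n X Y(1) by simp
  then show False using \<epsilon>(2) U(2) Y(1,2) by blast
qed

end
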